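(* For every prime $p>2$ and every positive integer $n$, the $\mathrm{VC}$-dimension of $\mathrm{GS}(p,n)\subseteq\mathbb{F}_p^n$ is at most $3$.
   Context: Let $w_1,\dots,w_n$ be the standard basis of $\mathbb{F}_p^n$. The linear Green–Sanders example is $\mathrm{GS}(p,n)=\{x\in\mathbb{F}_p^n : \exists i \text{ such that } w_j^T x = 0 \text{ for all } j<i \text{ and } w_i^T x = 1\}$. For a finite abelian group $G$ and $A\subseteq G$, $A$ has $\mathrm{VC}$-dimension at least $k$ ($k\ge1$) if there exist elements $\{x_i : i\in[k]\}\cup\{y_S : S\subseteq[k]\}$ of $G$ such that $x_i+y_S\in A$ if and only if $i\in S$; the $\mathrm{VC}$-dimension of $A$ is the largest such $k$. *)

theory Defs
  imports "HOL-Number_Theory.Residues" "HOL-Algebra.Product_Groups"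
begin

subsection \<open>VC-dimension of a subset of an abelian group\<close>

text \<open>The group operation, additive in the literature, is \<open>\<otimes>\<^bsub>G\<^esub>\<close>.\<close>

definition vc_dim_at_least :: "('a, 'b) monoid_scheme \<Rightarrow> 'a set \<Rightarrow> nat \<Rightarrow> bool" where
  "vc_dim_at_least G A k \<longleftrightarrow>
     (\<exists>(x :: nat \<Rightarrow> 'a) (y :: nat set \<Rightarrow> 'a).
        (\<forall>i\<in>{1..k}. x i \<in> carrier G) \<and>
        (\<forall>S\<in>Pow {1..k}. y S \<in> carrier G) \<and>
        (\<forall>i\<in>{1..k}. \<forall>S\<in>Pow {1..k}. x i \<otimes>\<^bsub>G\<^esub> y S \<in> A \<longleftrightarrow> i \<in> S))"

text \<open>
  The largest \<open>k \<ge> 1\<close> such that the VC-dimension is at least \<open>k\<close>, with the value \<open>0\<close> if there is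
  no such \<open>k\<close>. The set under \<^const>\<open>Max\<close> is finite whenever \<open>carrier G\<close> is finite; see the
  lemma \<open>finite_vc_dim_at_least\<close> below.
\<close>

definition vc_dim :: "('a, 'b) monoid_scheme \<Rightarrow> 'a set \<Rightarrow> nat" where
  "vc_dim G A = Max (insert 0 {k. 1 \<le> k \<and> vc_dim_at_least G A k})"

lemma vc_dim_at_least_le_card:
  assumes "finite (carrier G)" "vc_dim_at_least G A k"
  shows "2 ^ k \<le> card (carrier G)"
proof -
  obtain x y where y: "\<forall>S\<in>Pow {1..k}. y S \<in> carrier G"
    and xy: "\<forall>i\<in>{1..k}. \<forall>S\<in>Pow {1..k}. x i \<otimes>\<^bsub>G\<^esub> y S \<in> A \<longleftrightarrow> i \<in> S"
    using assms(2) unfolding vc_dim_at_least_def by blast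
  have "inj_on y (Pow {1..k})"
  proof (rule inj_onI)
    fix S T assume S: "S \<in> Pow {1..k}" and T: "T \<in> Pow {1..k}" and eq: "y S = y T"
    have "i \<in> S \<longleftrightarrow> i \<in> T" if "i \<in> {1..k}" for i
      using xy that S T eq by metis
    then show "S = T" using S T by blast
  qed
  then have "card (Pow {1..k}) \<le> card (carrier G)"
    using y assms(1) by (intro card_inj_on_le[of y]) auto
  then show ?thesis by (simp add: card_Pow)
qed

lemma finite_vc_dim_at_least:
  assumes "finite (carrier G)"
  shows "finite {k. 1 \<le> k \<and> vc_dim_at_least G A k}"
proof (rule finite_subset)
  show "{k. 1 \<le> k \<and> vc_dim_at_least G A k} \<subseteq> {..card (carrier G)}"
    using vc_dim_at_least_le_card[OF assms, of A] less_exp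
    by (force intro: order.trans[OF less_imp_le[OF less_exp]])
qed simp


subsection \<open>The linear Green--Sanders example\<close>

text \<open>
  The field of \<open>p\<close> elements is \<open>residue_ring (int p)\<close>, with carrier \<open>{0..int p - 1}\<close>; vectors are
  extensional functions on the index set \<open>{1..n}\<close>.
\<close>

abbreviation Fp :: "nat \<Rightarrow> int ring" where
  "Fp p \<equiv> residue_ring (int p)"

definition Fp_vec :: "nat \<Rightarrow> nat \<Rightarrow> (nat \<Rightarrow> int) monoid" where
  "Fp_vec p n = product_group {1..n} (\<lambda>_. add_monoid (Fp p))"

definition std_basis :: "nat \<Rightarrow> nat \<Rightarrow> nat \<Rightarrow> nat \<Rightarrow> int" where
  "std_basis p n i = (\<lambda>j\<in>{1..n}. if j = i then \<one>\<^bsub>Fp p\<^esub> else \<zero>\<^bsub>Fp p\<^esub>)"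

definition Fp_dot :: "nat \<Rightarrow> nat \<Rightarrow> (nat \<Rightarrow> int) \<Rightarrow> (nat \<Rightarrow> int) \<Rightarrow> int" where
  "Fp_dot p n u v = (\<Oplus>\<^bsub>Fp p\<^esub>i\<in>{1..n}. u i \<otimes>\<^bsub>Fp p\<^esub> v i)"

definition GS :: "nat \<Rightarrow> nat \<Rightarrow> (nat \<Rightarrow> int) set" where
  "GS p n = {x \<in> carrier (Fp_vec p n). \<exists>i\<in>{1..n}.
     (\<forall>j\<in>{1..<i}. Fp_dot p n (std_basis p n j) x = \<zero>\<^bsub>Fp p\<^esub>) \<and>
     Fp_dot p n (std_basis p n i) x = \<one>\<^bsub>Fp p\<^esub>}"

lemma finite_carrier_Fp_vec: "finite (carrier (Fp_vec p n))"
  by (simp add: Fp_vec_def residue_ring_def finite_PiE)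

lemma comm_group_Fp_vec:
  assumes "1 < p"
  shows "comm_group (Fp_vec p n)"
proof -
  interpret residues "int p" "Fp p" by unfold_locales (use assms in auto)
  have g: "group (Fp_vec p n)"
    unfolding Fp_vec_def by (intro product_group) (rule a_group)
  show ?thesis
    by (rule group.group_comm_groupI[OF g])
      (auto simp: Fp_vec_def PiE_iff intro!: restrict_ext a_comm)
qed

lemma Fp_dot_std_basis:
  assumes "1 < p" "i \<in> {1..n}" "x \<in> carrier (Fp_vec p n)"
  shows "Fp_dot p n (std_basis p n i) x = x i"
proof -
  interpret residues "int p" "Fp p" by unfold_locales (use assms in auto)
  have x: "x j \<in> carrier (Fp p)" if "j \<in> {1..n}" for j
    using assms(3) that by (auto simp: Fp_vec_def PiE_iff)
  have "Fp_dot p n (std_basis p n i) x =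
      (\<Oplus>\<^bsub>Fp p\<^esub>j\<in>{1..n}. if i = j then x j else \<zero>\<^bsub>Fp p\<^esub>)"
    unfolding Fp_dot_def using x
    by (intro finsum_cong') (auto simp: std_basis_def)
  also have "\<dots> = x i"
    using assms(2) x by (intro add.finprod_singleton) auto
  finally show ?thesis .
qed

end

theory Submission
  imports Defs
begin

text \<open>
  Suppose that \<open>x i\<close> (\<open>i \<in> {1..k}\<close>, \<open>k \<ge> 4\<close>) are shattered by the \<open>y S\<close>, and let \<open>c\<close> be the first
  coordinate at which the \<open>x i\<close> are not all equal. For a proper nonempty \<open>S\<close>, the sums \<open>x i + y S\<close>
  vanish before \<open>c\<close>: otherwise their common first nonzero entry would put all or none of them into
  the Green--Sanders set. So at \<open>c\<close> the sum is \<open>0\<close> or \<open>1\<close> if \<open>i \<in> S\<close>, and not \<open>1\<close> if \<open>i \<notin> S\<close>.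
  Taking sets \<open>S\<close> with one, two and three elements, these one-dimensional conditions already force
  all \<open>x i\<close> to agree at \<open>c\<close>.
\<close>

text \<open>Pairing with a standard basis vector reads off a coordinate, so membership can be tested
  on the integer entries themselves.\<close>

lemma mem_GS_iff:
  assumes "1 < p" "z \<in> carrier (Fp_vec p n)"
  shows "z \<in> GS p n \<longleftrightarrow> (\<exists>i\<in>{1..n}. (\<forall>j\<in>{1..<i}. z j = 0) \<and> z i = 1)"
proof -
  interpret residues "int p" "Fp p" by unfold_locales (use assms in auto)
  have "(\<forall>j\<in>{1..<i}. Fp_dot p n (std_basis p n j) z = 0) \<longleftrightarrow> (\<forall>j\<in>{1..<i}. z j = 0)"
    if "i \<in> {1..n}" for i
    using that Fp_dot_std_basis[OF assms(1) _ assms(2)] by (intro ball_cong) auto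
  then show ?thesis
    using assms Fp_dot_std_basis[OF assms(1) _ assms(2)]
    by (auto simp: GS_def zero_cong one_cong)
qed

text \<open>The index \<open>i\<close> witnessing \<open>z \<in> GS p n\<close> cannot lie beyond
  the nonzero entry at \<open>b\<close>, so it lies before \<open>c\<close>, where \<open>z\<close>
  and \<open>z'\<close> agree.\<close>

lemma GS_cong_prefix:
  assumes "1 < p" "z \<in> carrier (Fp_vec p n)" "z' \<in> carrier (Fp_vec p n)"
    and eq: "\<And>j. j \<in> {1..<c} \<Longrightarrow> z j = z' j" and nz: "b \<in> {1..<c}" "z b \<noteq> 0"
    and "z \<in> GS p n"
  shows "z' \<in> GS p n"
proof -
  obtain i where i: "i \<in> {1..n}" "\<forall>j\<in>{1..<i}. z j = 0" "z i = 1"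
    using assms mem_GS_iff by blast
  have "i < c" using i nz by (metis atLeastLessThan_iff le_less_trans not_le)
  then have "(\<forall>j\<in>{1..<i}. z' j = 0) \<and> z' i = 1"
    using i eq by (metis atLeastAtMost_iff atLeastLessThan_iff order.strict_trans)
  then show ?thesis using i(1) assms mem_GS_iff by blast
qed

text \<open>A witness for \<open>z\<close> cannot come before \<open>c\<close>, where all entries
  are 0. It is either \<open>c\<close>, with entry 1, or later, which forces entry 0 at
  \<open>c\<close>.\<close>

lemma GS_first_coordinate:
  assumes "1 < p" "z \<in> carrier (Fp_vec p n)" "c \<in> {1..n}" "\<And>j. j \<in> {1..<c} \<Longrightarrow> z j = 0"
  shows "z \<in> GS p n \<Longrightarrow> z c \<in> {0, 1}" "z c = 1 \<Longrightarrow> z \<in> GS p n"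
proof -
  show "z \<in> GS p n" if "z c = 1" using that assms mem_GS_iff by blast
  assume "z \<in> GS p n"
  then obtain i where i: "i \<in> {1..n}" "\<forall>j\<in>{1..<i}. z j = 0" "z i = 1"
    using assms mem_GS_iff by blast
  have "c \<le> i" using assms(4)[of i] i by force
  then show "z c \<in> {0, 1}" using i assms(3) by (cases "i = c") auto
qed

lemma Fp_vec_carrierD:
  assumes "1 < p" "z \<in> carrier (Fp_vec p n)" "i \<in> {1..n}"
  shows "0 \<le> z i" "z i < int p"
proof -
  have "z i \<in> carrier (Fp p)" using assms by (auto simp: Fp_vec_def)
  then show "0 \<le> z i" "z i < int p" by (auto simp: residue_ring_def)
qed

lemma Fp_vec_mult:
  assumes "i \<in> {1..n}"
  shows "(z \<otimes>\<^bsub>Fp_vec p n\<^esub> z') i = (z i + z' i) mod int p"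
  using assms by (simp add: Fp_vec_def residue_ring_def)

text \<open>Two representatives add up to less than \<open>2 * p\<close>, so reduction subtracts
  \<open>p\<close> at most once. This turns the modular conditions into linear arithmetic.\<close>

lemma mod_add_eq_0_or_1_iff:
  fixes p a b :: int
  assumes "2 < p" "0 \<le> a" "a < p" "0 \<le> b" "b < p"
  shows "(a + b) mod p = 0 \<longleftrightarrow> a + b = 0 \<or> a + b = p"
    and "(a + b) mod p = 1 \<longleftrightarrow> a + b = 1 \<or> a + b = p + 1"
proof -
  have "(a + b) mod p = (if a + b < p then a + b else a + b - p)"
    using assms mod_pos_pos_trivial[of "a + b - p" p] by simp
  then show "(a + b) mod p = 0 \<longleftrightarrow> a + b = 0 \<or> a + b = p"
    "(a + b) mod p = 1 \<longleftrightarrow> a + b = 1 \<or> a + b = p + 1"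
    using assms by smt+
qed

text \<open>This is what shattering leaves visible at the coordinate \<open>c\<close>, with
  \<open>d i\<close> for \<open>x i c\<close> and \<open>u S\<close> for \<open>y S c\<close>. The
  conditions are asymmetric because an entry 0 at \<open>c\<close> leaves membership to later
  coordinates.\<close>

locale one_dim_shattering =
  fixes p :: int and I :: "'a set" and d :: "'a \<Rightarrow> int" and u :: "'a set \<Rightarrow> int"
  assumes p: "2 < p"
    and d: "i \<in> I \<Longrightarrow> 0 \<le> d i \<and> d i < p"
    and u: "S \<subseteq> I \<Longrightarrow> 0 \<le> u S \<and> u S < p"
    and mem: "\<lbrakk>S \<subset> I; i \<in> S\<rbrakk> \<Longrightarrow> (d i + u S) mod p \<in> {0, 1}"
    and nmem: "\<lbrakk>S \<subset> I; S \<noteq> {}; i \<in> I; i \<notin> S\<rbrakk> \<Longrightarrow> (d i + u S) mod p \<noteq> 1"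
begin

lemma sum_in:
  assumes "S \<subset> I" "i \<in> S"
  shows "d i + u S = 0 \<or> d i + u S = p \<or> d i + u S = 1 \<or> d i + u S = p + 1"
proof -
  have "0 \<le> d i" "d i < p" "0 \<le> u S" "u S < p" using assms d u by auto
  from mod_add_eq_0_or_1_iff[OF p this] mem[OF assms] show ?thesis by blast
qed

lemma sum_not_in:
  assumes "S \<subset> I" "S \<noteq> {}" "i \<in> I" "i \<notin> S"
  shows "d i + u S \<noteq> 1 \<and> d i + u S \<noteq> p + 1"
proof -
  have "0 \<le> d i" "d i < p" "0 \<le> u S" "u S < p" using assms d u by auto
  from mod_add_eq_0_or_1_iff(2)[OF p this] nmem[OF assms] show ?thesis by blast
qed

text \<open>For representatives in \<open>{0..<p}\<close> this is the congruence of \<open>b\<close>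
  and \<open>a + 1\<close> modulo \<open>p\<close>, in a form suited to linear arithmetic.\<close>

definition succ_mod :: "int \<Rightarrow> int \<Rightarrow> bool" where
  "succ_mod a b \<longleftrightarrow> b = a + 1 \<or> b = 0 \<and> a = p - 1"

text \<open>Adding the same \<open>u S\<close> brings both values into {0, 1} modulo
  \<open>p\<close>, so they differ by 0 or by 1 up to sign.\<close>

lemma eq_or_succ_mod:
  assumes "S \<subset> I" "i \<in> S" "j \<in> S"
  shows "d i = d j \<or> succ_mod (d i) (d j) \<or> succ_mod (d j) (d i)"
proof -
  have "0 \<le> d i" "d i < p" "0 \<le> d j" "d j < p" using assms d by auto
  then show ?thesis
    using sum_in[OF assms(1,2)] sum_in[OF assms(1,3)] unfolding succ_mod_def by smt
qed

text \<open>Two sums in {0, 1} modulo \<open>p\<close> that differ by one step must be 0 and 1 in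
  this order, since \<open>2 < p\<close> rules out a step from 1 to 0.\<close>

lemma succ_mod_mem:
  assumes "S \<subset> I" "i \<in> S" "j \<in> S" "succ_mod (d j) (d i)"
  shows "d i + u S = 1 \<or> d i + u S = p + 1"
proof -
  have "0 \<le> d i" "d i < p" "0 \<le> d j" "d j < p" using assms d by auto
  then show ?thesis
    using sum_in[OF assms(1,2)] sum_in[OF assms(1,3)] assms(4) p unfolding succ_mod_def by smt
qed

text \<open>A third index \<open>k\<close> is compared with \<open>i\<close> and \<open>j\<close>;
  the fourth index \<open>l\<close> keeps \<open>{i, j, k}\<close> a proper subset of
  \<open>I\<close>.\<close>

lemma no_succ_mod:
  assumes I: "i \<in> I" "j \<in> I" "k \<in> I" "l \<in> I" and ne: "distinct [i, j, k, l]"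
  shows "\<not> succ_mod (d j) (d i)"
proof
  assume ji: "succ_mod (d j) (d i)"
  have ss: "{i, j} \<subset> I" "{i, k} \<subset> I" "{j, k} \<subset> I" "{i, j, k} \<subset> I" "{j} \<subset> I"
    using I ne by auto
  note r = p d[OF I(1)] d[OF I(2)] d[OF I(3)]
  \<comment> \<open>With \<open>S = {i, j}\<close> the sum at \<open>i\<close> is 1 modulo
    \<open>p\<close>, a value forbidden at \<open>k\<close>, which lies outside
    \<open>S\<close>.\<close>
  have ki: "d k \<noteq> d i"
    using succ_mod_mem[OF ss(1) _ _ ji] sum_not_in[OF ss(1) _ I(3)] ne by auto
  have kj: "d k = d j"
  proof (rule ccontr)
    assume kj: "d k \<noteq> d j"
    \<comment> \<open>If \<open>d k\<close> differs from both values, the steps from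
      \<open>d j\<close> to \<open>d i\<close> to \<open>d k\<close> and back to \<open>d j\<close>
      form a cycle, possible only for \<open>p = 3\<close>.\<close>
    have ik: "succ_mod (d i) (d k)"
    proof -
      have "succ_mod (d i) (d k) \<or> succ_mod (d k) (d i)"
        using eq_or_succ_mod[OF ss(2), of i k] ki by simp
      then show ?thesis using kj ji r unfolding succ_mod_def by smt
    qed
    have "succ_mod (d k) (d j)"
    proof -
      have "succ_mod (d j) (d k) \<or> succ_mod (d k) (d j)"
        using eq_or_succ_mod[OF ss(3), of k j] kj by auto
      then show ?thesis using ki ji r unfolding succ_mod_def by smt
    qed
    \<comment> \<open>On \<open>{i, j, k}\<close> both \<open>i\<close> and \<open>j\<close> end a
      step of the cycle, so both sums are 1 modulo \<open>p\<close>, although \<open>d i\<close> and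
      \<open>d j\<close> differ.\<close>
    then have "d i + u {i, j, k} = 1 \<or> d i + u {i, j, k} = p + 1"
      "d j + u {i, j, k} = 1 \<or> d j + u {i, j, k} = p + 1"
      using succ_mod_mem[OF ss(4) _ _ ji] succ_mod_mem[OF ss(4), of j k] by auto
    then show False using ji r unfolding succ_mod_def by smt
  qed
  \<comment> \<open>As \<open>d k = d j\<close> and \<open>k\<close> lies outside
    \<open>{j}\<close>, the sum at \<open>j\<close> cannot be 1 modulo \<open>p\<close>. Being 0
    there, it makes the sum at \<open>i\<close> equal to 1, which is forbidden as well.\<close>
  have "d j + u {j} = 0 \<or> d j + u {j} = p"
    using sum_in[OF ss(5), of j] sum_not_in[OF ss(5) _ I(3)] kj ne by auto
  moreover have "d i + u {j} \<noteq> 1 \<and> d i + u {j} \<noteq> p + 1"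
    using sum_not_in[OF ss(5) _ I(1)] ne by auto
  moreover have "0 \<le> u {j}" "u {j} < p" using u[of "{j}"] ss(5) by auto
  ultimately show False using ji r unfolding succ_mod_def by smt
qed

lemma d_eq:
  assumes I: "i \<in> I" "j \<in> I" "k \<in> I" "l \<in> I" and ne: "distinct [i, j, k, l]"
  shows "d i = d j"
proof -
  have "{i, j} \<subset> I" using I ne by auto
  then show ?thesis
    using eq_or_succ_mod[of "{i, j}" i j] no_succ_mod[OF I ne] no_succ_mod[OF I(2,1,3,4)] ne by auto
qed

end

lemma ex_two_others:
  fixes i j :: nat
  assumes "4 \<le> k"
  shows "\<exists>a b. a \<in> {1..k} \<and> b \<in> {1..k} \<and> a \<noteq> b \<and> a \<notin> {i, j} \<and> b \<notin> {i, j}"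
proof -
  have "2 \<le> card ({1..k} - {i, j})"
    using assms diff_card_le_card_Diff[of "{i, j}" "{1..k}"] card_insert_le_m1[of 2 "{j}" i] by simp
  then obtain B where B: "B \<subseteq> {1..k} - {i, j}" "card B = 2"
    using obtain_subset_with_card_n by metis
  then obtain a b where "B = {a, b}" "a \<noteq> b" by (auto simp: card_2_iff)
  then show ?thesis using B(1) by blast
qed

lemma not_vc_dim_at_least_GS:
  assumes "2 < p" "4 \<le> k"
  shows "\<not> vc_dim_at_least (Fp_vec p n) (GS p n) k"
proof
  have p1: "1 < p" using assms by simp
  interpret G: comm_group "Fp_vec p n" by (rule comm_group_Fp_vec[OF p1])
  assume "vc_dim_at_least (Fp_vec p n) (GS p n) k"
  then obtain x :: "nat \<Rightarrow> nat \<Rightarrow> int" and y :: "nat set \<Rightarrow> nat \<Rightarrow> int"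
    where x: "\<And>i. i \<in> {1..k} \<Longrightarrow> x i \<in> carrier (Fp_vec p n)"
      and y: "\<And>S. S \<subseteq> {1..k} \<Longrightarrow> y S \<in> carrier (Fp_vec p n)"
      and xy: "\<And>i S. \<lbrakk>i \<in> {1..k}; S \<subseteq> {1..k}\<rbrakk> \<Longrightarrow> x i \<otimes>\<^bsub>Fp_vec p n\<^esub> y S \<in> GS p n \<longleftrightarrow> i \<in> S"
    unfolding vc_dim_at_least_def by (metis PowI)
  define z where "z i S = x i \<otimes>\<^bsub>Fp_vec p n\<^esub> y S" for i S
  have z: "z i S \<in> carrier (Fp_vec p n)" if "i \<in> {1..k}" "S \<subseteq> {1..k}" for i S
    using that x y by (simp add: z_def)
  have zc: "z i S c = (x i c + y S c) mod int p" if "c \<in> {1..n}" for i S c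
    using that by (simp add: z_def Fp_vec_mult)
  define P where "P c \<longleftrightarrow> c \<in> {1..n} \<and> (\<exists>i\<in>{1..k}. \<exists>j\<in>{1..k}. x i c \<noteq> x j c)" for c
  have oneI: "1 \<in> {1..k}" and twoI: "2 \<in> {1..k}" using assms by auto
  \<comment> \<open>The set \<open>{1}\<close> separates the two indices, so some coordinate
    satisfies \<open>P\<close>.\<close>
  have "x 1 \<noteq> x 2" using xy[OF oneI, of "{1}"] xy[OF twoI, of "{1}"] oneI by auto
  moreover have "x 1 \<in> {1..n} \<rightarrow>\<^sub>E carrier (Fp p)" "x 2 \<in> {1..n} \<rightarrow>\<^sub>E carrier (Fp p)"
    using x[OF oneI] x[OF twoI] by (simp_all add: Fp_vec_def)
  ultimately obtain c where "c \<in> {1..n}" "x 1 c \<noteq> x 2 c"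
    using PiE_ext[of "x 1" "{1..n}" _ "x 2"] by blast
  then have "P c"
    unfolding P_def using oneI twoI by blast
  then obtain c where c: "P c" "\<And>b. b < c \<Longrightarrow> \<not> P b"
    using exists_least_iff[of P] by blast
  then have cn: "c \<in> {1..n}" by (simp add: P_def)
  have zero: "z i S b = 0" if "i \<in> {1..k}" "S \<subset> {1..k}" "S \<noteq> {}" "b \<in> {1..<c}" for i S b
  proof (rule ccontr)
    assume nz: "z i S b \<noteq> 0"
    have eq: "z i' S b = z j S b" if "i' \<in> {1..k}" "j \<in> {1..k}" "b \<in> {1..<c}" for i' j b
    proof -
      have b: "b \<in> {1..n}" "b < c" using that cn by auto
      have "x i' b = x j b" using c(2)[OF b(2)] b(1) that unfolding P_def by blast
      then show ?thesis using b by (simp only: zc)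
    qed
    \<comment> \<open>The nonzero entry before \<open>c\<close> carries the membership of
      \<open>z s S\<close> over to \<open>z t S\<close>, although \<open>t\<close> is not in
      \<open>S\<close>.\<close>
    obtain s t where st: "s \<in> S" "t \<in> {1..k}" "t \<notin> S" using \<open>S \<subset> {1..k}\<close> \<open>S \<noteq> {}\<close> by blast
    have sk: "s \<in> {1..k}" and Sk: "S \<subseteq> {1..k}" using st that by auto
    have "z t S \<in> GS p n"
    proof (rule GS_cong_prefix[OF p1 z[OF sk Sk] z[OF st(2) Sk]])
      show "z s S j = z t S j" if "j \<in> {1..<c}" for j using eq[OF sk st(2) that] .
      show "b \<in> {1..<c}" by (rule that(4))
      show "z s S b \<noteq> 0" using eq[OF that(1) sk that(4)] nz by simp
      show "z s S \<in> GS p n" using xy[OF sk Sk] st(1) by (simp add: z_def)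
    qed
    then show False using xy[OF st(2) Sk] st by (simp add: z_def)
  qed
  interpret one_dim_shattering "int p" "{1..k}" "\<lambda>i. x i c" "\<lambda>S. y S c"
  proof
    show "2 < int p" using assms by simp
    show "0 \<le> x i c \<and> x i c < int p" if "i \<in> {1..k}" for i
      using Fp_vec_carrierD[OF p1 x[OF that] cn] by simp
    show "0 \<le> y S c \<and> y S c < int p" if "S \<subseteq> {1..k}" for S
      using Fp_vec_carrierD[OF p1 y[OF that] cn] by simp
    show "(x i c + y S c) mod int p \<in> {0, 1}" if "S \<subset> {1..k}" "i \<in> S" for i S
    proof -
      have i: "i \<in> {1..k}" "S \<subseteq> {1..k}" "S \<noteq> {}" using that by auto
      have "z i S \<in> GS p n" using xy[OF i(1,2)] that by (simp add: z_def)
      then show ?thesis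
        using GS_first_coordinate(1)[OF p1 z[OF i(1,2)] cn] zero[OF i(1) that(1) i(3)] zc[OF cn, of i S]
        by simp
    qed
    show "(x i c + y S c) mod int p \<noteq> 1"
      if "S \<subset> {1..k}" "S \<noteq> {}" "i \<in> {1..k}" "i \<notin> S" for i S
    proof -
      have S: "S \<subseteq> {1..k}" using that by auto
      have "z i S \<notin> GS p n" using xy[OF that(3) S] that by (simp add: z_def)
      then show ?thesis
        using GS_first_coordinate(2)[OF p1 z[OF that(3) S] cn] zero[OF that(3,1,2)] zc[OF cn, of i S]
        by auto
    qed
  qed
  obtain i j where ij: "i \<in> {1..k}" "j \<in> {1..k}" "x i c \<noteq> x j c"
    using c(1) by (auto simp: P_def)
  obtain a b where "a \<in> {1..k}" "b \<in> {1..k}" "a \<noteq> b" "a \<notin> {i, j}" "b \<notin> {i, j}"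
    using ex_two_others[OF assms(2)] by blast
  then show False using d_eq[of i j a b] ij by auto
qed

theorem theorem2p2:
  fixes p n :: nat
  assumes "prime p" and "p > 2" and "n \<ge> 1"
  shows "vc_dim (Fp_vec p n) (GS p n) \<le> 3"
proof -
  have "k \<le> 3" if "vc_dim_at_least (Fp_vec p n) (GS p n) k" for k
    using not_vc_dim_at_least_GS[OF assms(2), of k n] that by (cases "4 \<le> k") auto
  \<comment> \<open>Finiteness lets \<open>Max\<close> be bounded elementwise; the inserted default
    0 satisfies the bound.\<close>
  then show ?thesis
    unfolding vc_dim_def using finite_vc_dim_at_least[OF finite_carrier_Fp_vec] by simp
qed

end
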